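(* Let $x_t=[x_{i,t}]_{i=1}^p$, $t=1,\dots,n$, be zero mean random variables on a common probability space (with arbitrary dependence), let $\mathcal{M}_n>0$, and suppose $\bar{\mathbb{P}}_{\mathcal{M}_n}:=\max_{1\le i\le p}\mathbb{P}(|\bar x_{i,n}|>\mathcal{M}_n)\in(0,1)$, where $\bar x_{i,n}:=\frac1n\sum_{t=1}^nx_{i,t}$. Then for any $\zeta\in(0,1]$, $$\mathbb{P}\left(\max_{1\le i\le p}|\bar x_{i,n}|>\mathcal{M}_n\right)\le\frac{\ln(p)}{\ln(\bar{\mathbb{P}}_{\mathcal{M}_n}^{-\zeta})}+\frac{\bar{\mathbb{P}}_{\mathcal{M}_n}^{1-\zeta}}{\ln(\bar{\mathbb{P}}_{\mathcal{M}_n}^{-\zeta})}.$$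
   Context: All notation is standard or defined in the claim; $p$ and $n$ are positive integers. *)

theory Defs
  imports "HOL-Probability.Probability"
begin

definition sample_mean :: "(nat \<Rightarrow> nat \<Rightarrow> 'a \<Rightarrow> real) \<Rightarrow> nat \<Rightarrow> nat \<Rightarrow> 'a \<Rightarrow> real" where
  "sample_mean x n i \<omega> = (1 / real n) * (\<Sum>t = 1..n. x i t \<omega>)"

definition max_tail_prob ::
  "'a measure \<Rightarrow> (nat \<Rightarrow> nat \<Rightarrow> 'a \<Rightarrow> real) \<Rightarrow> nat \<Rightarrow> nat \<Rightarrow> real \<Rightarrow> real" where
  "max_tail_prob \<Omega> x p n M =
     (MAX i\<in>{1..p}. measure \<Omega> {\<omega> \<in> space \<Omega>. \<bar>sample_mean x n i \<omega>\<bar> > M})"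

end

theory Submission
  imports Defs
begin

text \<open>With $q$ the probability of the union, the union bound and the convexity estimate
  $e^{lq} \le 1 + q(e^l - 1)$ bound $e^{lq}$ by $p\,(1 + P(e^l - 1)) \le p\,e^{P e^l}$,
  where $p$ is the number of events and $P$ bounds their probabilities. Taking logarithms with
  $l = \ln(P^{-\zeta})$, so that $P e^l = P^{1-\zeta}$, and dividing by $l > 0$ gives the theorem.\<close>

lemma (in prob_space) measure_UN_le_ln_card:
  fixes l P :: real
  assumes fin: "finite I" and ne: "I \<noteq> {}"
    and ev: "\<And>i. i \<in> I \<Longrightarrow> A i \<in> events"
    and le: "\<And>i. i \<in> I \<Longrightarrow> prob (A i) \<le> P"
    and l: "l \<ge> 0"
  shows "l * prob (\<Union>i\<in>I. A i) \<le> ln (real (card I)) + P * exp l"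
proof -
  define q where "q = prob (\<Union>i\<in>I. A i)"
  have q: "0 \<le> q" "q \<le> 1"
    by (auto simp: q_def)
  have card: "real (card I) \<ge> 1"
    using fin ne by (simp add: Suc_leI card_gt_0_iff)
  have "q \<le> (\<Sum>i\<in>I. prob (A i))"
    unfolding q_def using fin ev by (intro finite_measure_subadditive_finite) auto
  also have "\<dots> \<le> real (card I) * P"
    using le by (rule sum_bounded_above)
  finally have union: "q \<le> real (card I) * P" .
  have e: "exp l \<ge> 1"
    using l by simp
  \<comment> \<open>The point \<open>l * q\<close> is the convex combination of \<open>0\<close> and
    \<open>l\<close> with weight \<open>q\<close>, so \<open>exp\<close> there lies below its chord.
    This is where \<open>q\<close> being a probability matters.\<close>
  have "exp (l * q) \<le> 1 + q * (exp l - 1)"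
    using convex_onD[OF exp_convex, of q 0 l] q by (simp add: algebra_simps)
  \<comment> \<open>Enlarging the leading \<open>1\<close> to \<open>card I\<close> lets the
    cardinality factor out of both terms; the union bound may be multiplied by
    \<open>exp l - 1\<close> because \<open>l \<ge> 0\<close>.\<close>
  also have "\<dots> \<le> real (card I) + real (card I) * P * (exp l - 1)"
    using union e card by (intro add_mono mult_right_mono) auto
  also have "\<dots> = real (card I) * (1 + P * (exp l - 1))"
    by (simp add: algebra_simps)
  also have "\<dots> \<le> real (card I) * exp (P * exp l)"
  proof (intro mult_left_mono)
    \<comment> \<open>Since \<open>I\<close> is nonempty, \<open>P\<close> dominates the probability
      of some event.\<close>
    have "0 \<le> P"
      using ne le measure_nonneg by (meson all_not_in_conv order_trans)
    then have "1 + P * (exp l - 1) \<le> 1 + P * exp l"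
      by (simp add: algebra_simps)
    also have "\<dots> \<le> exp (P * exp l)"
      by (rule exp_ge_add_one_self)
    finally show "1 + P * (exp l - 1) \<le> exp (P * exp l)" .
  qed simp
  also have "\<dots> = exp (ln (real (card I)) + P * exp l)"
    using card by (simp add: exp_add)
  finally show ?thesis
    by (simp add: q_def)
qed

theorem mainTheorem4:
  fixes \<Omega> :: "'a measure"
    and x :: "nat \<Rightarrow> nat \<Rightarrow> 'a \<Rightarrow> real"
    and p n :: nat
    and M \<zeta> :: real
  assumes "prob_space \<Omega>"
    and "p \<ge> 1" and "n \<ge> 1"
    and "\<And>i t. i \<in> {1..p} \<Longrightarrow> t \<in> {1..n} \<Longrightarrow> x i t \<in> borel_measurable \<Omega>"
    and "\<And>i t. i \<in> {1..p} \<Longrightarrow> t \<in> {1..n} \<Longrightarrow> integrable \<Omega> (x i t)"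
    and "\<And>i t. i \<in> {1..p} \<Longrightarrow> t \<in> {1..n} \<Longrightarrow> (\<integral>\<omega>. x i t \<omega> \<partial>\<Omega>) = 0"
    and "M > 0"
    and "max_tail_prob \<Omega> x p n M \<in> {0<..<1}"
    and "\<zeta> \<in> {0<..1}"
  shows "measure \<Omega> {\<omega> \<in> space \<Omega>. (MAX i\<in>{1..p}. \<bar>sample_mean x n i \<omega>\<bar>) > M}
    \<le> ln (real p) / ln (max_tail_prob \<Omega> x p n M powr (- \<zeta>))
      + max_tail_prob \<Omega> x p n M powr (1 - \<zeta>) / ln (max_tail_prob \<Omega> x p n M powr (- \<zeta>))"
proof -
  interpret prob_space \<Omega> by fact
  define P where "P = max_tail_prob \<Omega> x p n M"
  define l where "l = ln (P powr (- \<zeta>))"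
  define A where "A i = {\<omega> \<in> space \<Omega>. \<bar>sample_mean x n i \<omega>\<bar> > M}" for i
  have P: "0 < P" "P < 1" and \<zeta>: "0 < \<zeta>"
    using assms(8,9) by (auto simp: P_def)
  \<comment> \<open>Here \<open>l = - \<zeta> * ln P\<close>, and \<open>ln P < 0\<close>.\<close>
  have l: "l > 0"
    using P \<zeta> by (simp add: l_def ln_powr mult_pos_neg)
  have Pl: "P * exp l = P powr (1 - \<zeta>)"
    using P by (simp add: l_def powr_diff powr_minus field_simps)
  have meas: "sample_mean x n i \<in> borel_measurable \<Omega>" if "i \<in> {1..p}" for i
    unfolding sample_mean_def[abs_def] using assms(4) that by measurable
  have ev: "A i \<in> events" if "i \<in> {1..p}" for i
    using meas[OF that, measurable] unfolding A_def by measurable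
  have le: "prob (A i) \<le> P" if "i \<in> {1..p}" for i
    using that unfolding P_def max_tail_prob_def A_def by (intro Max_ge) auto
  \<comment> \<open>A maximum over a finite nonempty set exceeds \<open>M\<close> iff some member
    does; \<open>p \<ge> 1\<close> supplies nonemptiness.\<close>
  have "{\<omega> \<in> space \<Omega>. (MAX i\<in>{1..p}. \<bar>sample_mean x n i \<omega>\<bar>) > M} = (\<Union>i\<in>{1..p}. A i)"
    using assms(2) by (subst Max_gr_iff) (auto simp: A_def)
  moreover have "l * prob (\<Union>i\<in>{1..p}. A i) \<le> ln (real p) + P powr (1 - \<zeta>)"
    using measure_UN_le_ln_card[of "{1..p}" A P l] ev le l assms(2) by (simp add: Pl)
  \<comment> \<open>The two fractions share the denominator \<open>l\<close>, so the claim is the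
    previous bound divided by \<open>l\<close>.\<close>
  ultimately show ?thesis
    unfolding P_def[symmetric] l_def[symmetric] add_divide_distrib[symmetric]
    using l by (simp add: pos_le_divide_eq mult.commute)
qed

end
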